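(* Let $m\geq 2$ be an integer and let $A$ be a finite subset of $\bigcup_{k\geq 2}\{1,\ldots,m-1\}^k$. Then $\mathscr{C}(m,A)$ is a Frobenius pseudo-variety.
   Context: $\mathbb{N}$ is the set of non-negative integers. A numerical semigroup is a subset $S\subseteq\mathbb{N}$ closed under addition, with $0\in S$ and $\mathbb{N}\setminus S$ finite. The multiplicity $\mathrm{m}(S)$ is the least positive element of $S$. The Frobenius number $\mathrm{F}(S)$ is the greatest integer not belonging to $S$. $\mathscr{S}_m$ is the set of numerical semigroups with multiplicity $m$. $x \bmod m$ denotes the remainder after division of $x$ by $m$. For an integer $m\ge 2$ and a finite set $A\subseteq\bigcup_{k\geq 2}\{1,\ldots,m-1\}^k$ (so elements of $A$ are tuples, possibly of different lengths $k\ge 2$), $\mathscr{C}(m,A)$ is the set of all $S\in\mathscr{S}_m$ such that for every $k\ge 2$ and every $(s_1,\ldots,s_k)\in S^k$ with $(s_1\bmod m,\ldots,s_k\bmod m)\in A$ one has $s_1+\cdots+s_k-m\in S$. A Frobenius pseudo-variety is a non-empty family $\mathcal{P}$ of numerical semigroups such that: (1) $\mathcal{P}$ has a maximum element $\max(\mathcal{P})$ with respect to inclusion; (2) if $S,T\in\mathcal{P}$, then $S\cap T\in\mathcal{P}$; (3) if $S\in\mathcal{P}$ and $S\neq\max(\mathcal{P})$, then $S\cup\{\mathrm{F}(S)\}\in\mathcal{P}$. *)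

theory Defs
  imports Main
begin

definition numerical_semigroup :: "nat set \<Rightarrow> bool" where
  "numerical_semigroup S \<longleftrightarrow>
     0 \<in> S \<and> (\<forall>x\<in>S. \<forall>y\<in>S. x + y \<in> S) \<and> finite (UNIV - S)"

definition semigroup_multiplicity :: "nat set \<Rightarrow> nat" where
  "semigroup_multiplicity S = (LEAST x. x \<in> S \<and> 0 < x)"

text \<open>The Frobenius number is an integer: it is \<open>-1\<close> for \<open>S = \<nat>\<close>.\<close>

definition frobenius_number :: "nat set \<Rightarrow> int" where
  "frobenius_number S = (GREATEST x. x \<notin> int ` S)"

definition semigroups_of_multiplicity :: "nat \<Rightarrow> nat set set" where
  "semigroups_of_multiplicity m =
     {S. numerical_semigroup S \<and> semigroup_multiplicity S = m}"

definition index_tuples :: "nat \<Rightarrow> nat list set" where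
  "index_tuples m = {a. 2 \<le> length a \<and> set a \<subseteq> {1..m - 1}}"

text \<open>The difference is formed in the integers, so that it is never truncated at \<open>0\<close>.\<close>

definition semigroup_class :: "nat \<Rightarrow> nat list set \<Rightarrow> nat set set" where
  "semigroup_class m A =
     {S \<in> semigroups_of_multiplicity m.
        \<forall>s. 2 \<le> length s \<longrightarrow> set s \<subseteq> S \<longrightarrow> map (\<lambda>x. x mod m) s \<in> A \<longrightarrow>
            int (sum_list s) - int m \<in> int ` S}"

text \<open>
  \<open>M\<close> is the maximum of \<open>P\<close>, which is unique. Adjoining the Frobenius number is
  expressed on the images in the integers; a set \<open>T\<close> of naturals is determined by \<open>int ` T\<close>.
\<close>

definition frobenius_pseudo_variety :: "nat set set \<Rightarrow> bool" where
  "frobenius_pseudo_variety P \<longleftrightarrow>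
     P \<noteq> {} \<and>
     (\<forall>S\<in>P. numerical_semigroup S) \<and>
     (\<exists>M\<in>P. (\<forall>S\<in>P. S \<subseteq> M) \<and>
        (\<forall>S\<in>P. S \<noteq> M \<longrightarrow>
           (\<exists>T\<in>P. int ` T = int ` S \<union> {frobenius_number S}))) \<and>
     (\<forall>S\<in>P. \<forall>T\<in>P. S \<inter> T \<in> P)"

end

theory Submission
  imports Defs
begin

text \<open>
  The maximum of the family is \<open>M = {0} \<union> {m..}\<close>. Entries of a tuple whose residues lie in \<open>A\<close> are
  not divisible by \<open>m\<close>, so they are nonzero and hence at least \<open>m + 1\<close>. If one of them is the adjoined
  Frobenius number \<open>F\<close>, a second entry makes the sum exceed \<open>F + m\<close>, and everything above \<open>F\<close>
  belongs to the semigroup. When \<open>S \<noteq> M\<close>, some number above \<open>m\<close> is missing, so \<open>F > m\<close> and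
  adjoining \<open>F\<close> does not change the multiplicity.
\<close>

text \<open>Trades \<open>LEAST\<close> for a membership and a lower bound, two conditions that are
  easy to check for intersections and for sets with one adjoined element.\<close>

lemma semigroups_of_multiplicity_iff:
  assumes "0 < m"
  shows "S \<in> semigroups_of_multiplicity m \<longleftrightarrow>
    numerical_semigroup S \<and> m \<in> S \<and> (\<forall>x\<in>S. x = 0 \<or> m \<le> x)"
proof
  assume "S \<in> semigroups_of_multiplicity m"
  then have S: "numerical_semigroup S" and m: "m = (LEAST x. x \<in> S \<and> 0 < x)"
    by (auto simp: semigroups_of_multiplicity_def semigroup_multiplicity_def)
  \<comment> \<open>A cofinite set has a positive element, so the \<open>LEAST\<close> is
    attained.\<close>
  have "infinite S"
    using S by (metis Diff_infinite_finite infinite_UNIV_nat numerical_semigroup_def)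
  then obtain y where y: "y \<in> S \<and> 0 < y"
    by (metis finite.emptyI finite_insert finite_subset gr0I insertI1 subsetI)
  have "m \<in> S"
    using LeastI[of "\<lambda>x. x \<in> S \<and> 0 < x", OF y] m by simp
  moreover have "x = 0 \<or> m \<le> x" if "x \<in> S" for x
    using Least_le[of "\<lambda>x. x \<in> S \<and> 0 < x" x] m that by auto
  ultimately show "numerical_semigroup S \<and> m \<in> S \<and> (\<forall>x\<in>S. x = 0 \<or> m \<le> x)"
    using S by blast
next
  assume "numerical_semigroup S \<and> m \<in> S \<and> (\<forall>x\<in>S. x = 0 \<or> m \<le> x)"
  then show "S \<in> semigroups_of_multiplicity m"
    unfolding semigroups_of_multiplicity_def semigroup_multiplicity_def
    using assms by (auto intro!: Least_equality)
qed

lemma int_diff_mem_image_iff: "int a - int m \<in> int ` S \<longleftrightarrow> m \<le> a \<and> a - m \<in> S"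
proof
  assume "int a - int m \<in> int ` S"
  then obtain b where "int a - int m = int b" "b \<in> S" by blast
  then have "a = m + b" by linarith
  then show "m \<le> a \<and> a - m \<in> S" using \<open>b \<in> S\<close> by simp
next
  assume "m \<le> a \<and> a - m \<in> S"
  then show "int a - int m \<in> int ` S" by (metis image_eqI of_nat_diff)
qed

lemma semigroup_class_iff:
  assumes "0 < m"
  shows "S \<in> semigroup_class m A \<longleftrightarrow>
    numerical_semigroup S \<and> m \<in> S \<and> (\<forall>x\<in>S. x = 0 \<or> m \<le> x) \<and>
    (\<forall>s. 2 \<le> length s \<longrightarrow> set s \<subseteq> S \<longrightarrow> map (\<lambda>x. x mod m) s \<in> A \<longrightarrow>
      m \<le> sum_list s \<and> sum_list s - m \<in> S)"
  unfolding semigroup_class_def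
  by (simp add: semigroups_of_multiplicity_iff[OF assms] int_diff_mem_image_iff)

text \<open>The missing \<open>n\<close> makes the complement nonempty, which excludes the value -1:
  the greatest gap is then a natural number, the \<open>Max\<close> of a finite set.\<close>

lemma frobenius_numberE:
  assumes "numerical_semigroup S" and "n \<notin> S"
  obtains g where "frobenius_number S = int g" and "g \<notin> S" and "n \<le> g" and "\<And>x. g < x \<Longrightarrow> x \<in> S"
proof -
  define g where "g = Max (UNIV - S)"
  have fin: "finite (UNIV - S)"
    using assms by (simp add: numerical_semigroup_def)
  have "g \<notin> S"
    using Max_in[OF fin] assms(2) g_def by blast
  moreover have le: "x \<le> g" if "x \<notin> S" for x
    using Max_ge[OF fin, of x] that g_def by blast
  moreover have "frobenius_number S = int g"
    unfolding frobenius_number_def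
  proof (rule Greatest_equality)
    show "int g \<notin> int ` S" using \<open>g \<notin> S\<close> by auto
    \<comment> \<open>Negative integers also lie outside the image, but they are below
      \<open>int g\<close> anyway.\<close>
    show "y \<le> int g" if "y \<notin> int ` S" for y
      by (cases y) (use that le in auto)
  qed
  ultimately show thesis
    using that assms(2) by (meson not_le)
qed

text \<open>Removing one occurrence of \<open>x\<close> leaves a nonempty list, any entry of which
  contributes at least \<open>k\<close>. Splitting at an occurrence also covers a repeated
  \<open>x\<close>.\<close>

lemma add_le_sum_list:
  fixes s :: "nat list"
  assumes "2 \<le> length s" and "x \<in> set s" and "\<forall>y\<in>set s. k \<le> y"
  shows "x + k \<le> sum_list s"
proof -
  obtain ys zs where s: "s = ys @ x # zs"
    using assms(2) by (meson split_list)
  with assms(1) obtain y where y: "y \<in> set (ys @ zs)"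
    by (cases "ys @ zs") auto
  then have "k \<le> y" using assms(3) s by auto
  moreover have "y \<le> sum_list (ys @ zs)" using y by (intro member_le_sum_list) auto
  ultimately show ?thesis by (simp add: s)
qed

lemma index_tuples_residue_nonzero:
  assumes "map (\<lambda>x. x mod m) s \<in> index_tuples m" and "x \<in> set s"
  shows "x mod m \<noteq> 0"
  using assms by (fastforce simp: index_tuples_def)

text \<open>Here \<open>S\<close> is an arbitrary set, so the bound serves both the maximum and a
  semigroup with an adjoined gap.\<close>

lemma sum_list_gt:
  assumes "map (\<lambda>x. x mod m) s \<in> index_tuples m" and "set s \<subseteq> S"
    and "\<forall>x\<in>S. x = 0 \<or> m \<le> x" and "x \<in> set s"
  shows "x + m < sum_list s"
proof -
  \<comment> \<open>A nonzero residue excludes the entry \<open>m\<close> as well as 0; the gain of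
    one makes the final inequality strict.\<close>
  have "\<forall>y\<in>set s. Suc m \<le> y"
    using index_tuples_residue_nonzero[OF assms(1)] assms(2,3)
    by (metis mod_0 mod_self nat_less_le not_less_eq_eq not_le subsetD)
  moreover have "2 \<le> length s"
    using assms(1) by (simp add: index_tuples_def)
  ultimately show ?thesis
    using add_le_sum_list assms(4) by fastforce
qed

lemma ordinary_semigroup_in_class:
  assumes "0 < m" and "A \<subseteq> index_tuples m"
  shows "insert 0 {m..} \<in> semigroup_class m A"
proof -
  have "UNIV - insert 0 {m..} \<subseteq> {..<m}" by auto
  then have "numerical_semigroup (insert 0 {m..})"
    using finite_subset by (auto simp: numerical_semigroup_def)
  moreover have "m \<le> sum_list s \<and> m \<le> sum_list s - m"
    if s: "2 \<le> length s" "set s \<subseteq> insert 0 {m..}" "map (\<lambda>x. x mod m) s \<in> A" for s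
  proof -
    have A: "map (\<lambda>x. x mod m) s \<in> index_tuples m" using s assms by blast
    obtain x where x: "x \<in> set s" using s(1) by (cases s) auto
    have "m \<le> x"
      using index_tuples_residue_nonzero[OF A x] s(2) x by auto
    then show ?thesis
      using sum_list_gt[OF A s(2) _ x] by auto
  qed
  ultimately show ?thesis
    using assms(1) by (auto simp: semigroup_class_iff)
qed

text \<open>Only two properties of the Frobenius number enter: it is at least \<open>m\<close>, and
  everything above it lies in \<open>S\<close>.\<close>

lemma insert_frobenius_in_class:
  assumes "0 < m" and "A \<subseteq> index_tuples m" and S: "S \<in> semigroup_class m A"
    and "m \<le> g" and above: "\<And>x. g < x \<Longrightarrow> x \<in> S"
  shows "insert g S \<in> semigroup_class m A"
proof -
  have ns: "numerical_semigroup S" and m: "m \<in> S" "\<forall>x\<in>S. x = 0 \<or> m \<le> x"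
    and cl: "\<And>s. 2 \<le> length s \<Longrightarrow> set s \<subseteq> S \<Longrightarrow> map (\<lambda>x. x mod m) s \<in> A \<Longrightarrow>
      m \<le> sum_list s \<and> sum_list s - m \<in> S"
    using S by (simp_all add: semigroup_class_iff[OF assms(1)])
  have T: "\<forall>x\<in>insert g S. x = 0 \<or> m \<le> x" using m assms(4) by blast
  have "x + y \<in> insert g S" if "x \<in> insert g S" "y \<in> insert g S" for x y
  proof (cases "x \<in> S \<and> y \<in> S")
    case True
    then show ?thesis using ns by (auto simp: numerical_semigroup_def)
  next
    case False
    \<comment> \<open>One summand is \<open>g\<close>; the sum stays \<open>g\<close> exactly when
      the other is 0.\<close>
    then have "x + y = g \<or> g < x + y" using that by auto
    then show ?thesis using above by blast
  qed
  moreover have "finite (UNIV - insert g S)"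
    using ns by (metis finite_Diff_insert numerical_semigroup_def)
  ultimately have "numerical_semigroup (insert g S)"
    using ns by (simp add: numerical_semigroup_def)
  moreover have "m \<le> sum_list s \<and> sum_list s - m \<in> insert g S"
    if s: "2 \<le> length s" "set s \<subseteq> insert g S" "map (\<lambda>x. x mod m) s \<in> A" for s
  \<comment> \<open>A tuple through \<open>g\<close> lands above \<open>g\<close>; a tuple avoiding
    \<open>g\<close> lies in \<open>S\<close>, whose own closure applies.\<close>
  proof (cases "g \<in> set s")
    case True
    have "map (\<lambda>x. x mod m) s \<in> index_tuples m" using s assms by blast
    from sum_list_gt[OF this s(2) T True] have "g < sum_list s - m" "m \<le> sum_list s" by auto
    then show ?thesis using above by blast
  next
    case False
    then show ?thesis using cl[of s] s by blast
  qed
  ultimately show ?thesis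
    using m T by (simp add: semigroup_class_iff[OF assms(1)])
qed

lemma Int_in_class:
  assumes "0 < m" and "S \<in> semigroup_class m A" and "T \<in> semigroup_class m A"
  shows "S \<inter> T \<in> semigroup_class m A"
proof -
  have "numerical_semigroup (S \<inter> T)"
    using assms(2,3)
    by (auto simp: semigroup_class_iff[OF assms(1)] numerical_semigroup_def Diff_Int)
  then show ?thesis
    using assms(2,3) by (simp add: semigroup_class_iff[OF assms(1)])
qed

theorem proposition2p6:
  fixes m :: nat and A :: "nat list set"
  assumes "2 \<le> m" and "finite A" and "A \<subseteq> index_tuples m"
  shows "frobenius_pseudo_variety (semigroup_class m A)"
proof -
  have m: "0 < m" using assms(1) by simp
  let ?M = "insert 0 {m..}"
  have M: "?M \<in> semigroup_class m A"
    by (rule ordinary_semigroup_in_class[OF m assms(3)])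
  have sub: "S \<subseteq> ?M" if "S \<in> semigroup_class m A" for S
    using that by (auto simp: semigroup_class_iff[OF m])
  have adj: "\<exists>T\<in>semigroup_class m A. int ` T = int ` S \<union> {frobenius_number S}"
    if S: "S \<in> semigroup_class m A" and "S \<noteq> ?M" for S
  proof -
    have ns: "numerical_semigroup S"
      using S by (simp add: semigroup_class_iff[OF m])
    then have "0 \<in> S" by (simp add: numerical_semigroup_def)
    \<comment> \<open>As 0 is in \<open>S\<close>, an element of \<open>?M\<close> missing from
      \<open>S\<close> must come from \<open>{m..}\<close>. It forces the Frobenius number to be at
      least \<open>m\<close>.\<close>
    then obtain n where n: "n \<notin> S" "m \<le> n"
      using sub[OF S] \<open>S \<noteq> ?M\<close> by auto
    obtain g where g: "frobenius_number S = int g" "n \<le> g" "\<And>x. g < x \<Longrightarrow> x \<in> S"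
      using frobenius_numberE[OF ns n(1)] by metis
    have "insert g S \<in> semigroup_class m A"
      using insert_frobenius_in_class[OF m assms(3) S _ g(3)] n(2) g(2) by simp
    then show ?thesis using g(1) by (intro bexI[of _ "insert g S"]) auto
  qed
  show ?thesis
    unfolding frobenius_pseudo_variety_def
  proof (intro conjI)
    show "semigroup_class m A \<noteq> {}" using M by blast
    show "\<forall>S\<in>semigroup_class m A. numerical_semigroup S"
      by (simp add: semigroup_class_iff[OF m])
    show "\<exists>M\<in>semigroup_class m A. (\<forall>S\<in>semigroup_class m A. S \<subseteq> M) \<and>
        (\<forall>S\<in>semigroup_class m A. S \<noteq> M \<longrightarrow>
           (\<exists>T\<in>semigroup_class m A. int ` T = int ` S \<union> {frobenius_number S}))"
      using M sub adj by (intro bexI[of _ ?M]) blast+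
    show "\<forall>S\<in>semigroup_class m A. \<forall>T\<in>semigroup_class m A. S \<inter> T \<in> semigroup_class m A"
      using Int_in_class[OF m] by blast
  qed
qed

end
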